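(* Let $d\in\mathbb{N}$, $C=[-d:d]=\{-d,\dots,d\}$ and $\mathbf{x}=(x_1,\dots,x_n)\in\mathbb{Z}^n\setminus\{\mathbf{0}\}$. If \[ \frac{\|\mathbf{x}\|_2}{\gcd(x_1,\ldots,x_n)}<(d+1)^{n-1}, \] then there exists $\mathbf{c}\in C^n\setminus\{\mathbf{0}\}$ such that $\mathbf{c}\cdot\mathbf{x}=0$.
   Context: $\|\mathbf{x}\|_2$ is the Euclidean norm and $\mathbf{c}\cdot\mathbf{x}=\sum_i c_ix_i$. *)

theory Defs
  imports "HOL-Analysis.Analysis"
begin

definition real_of_int_vec :: "int ^ 'n \<Rightarrow> real ^ 'n" where
  "real_of_int_vec x = (\<chi> i. real_of_int (x $ i))"

definition int_dot :: "int ^ 'n \<Rightarrow> int ^ 'n \<Rightarrow> int" where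
  "int_dot c x = (\<Sum>i\<in>UNIV. c $ i * x $ i)"

end

theory Submission imports Defs begin

text \<open>
  Divide \<open>x\<close> by its gcd to get \<open>y\<close>, put \<open>D = d + 1\<close>, and consider the \<open>D ^ n\<close> integers
  \<open>c \<bullet> y\<close> with \<open>c \<in> {0..d} ^ n\<close>. For uniformly random \<open>c\<close> their variance is
  \<open>(D\<^sup>2 - 1) \<parallel>y\<parallel>\<^sup>2 / 12\<close>. If they were pairwise distinct, the variance would be at least that of
  \<open>D ^ n\<close> consecutive integers, namely \<open>(D ^ (2 * n) - 1) / 12\<close>, which contradicts
  \<open>\<parallel>y\<parallel> < D ^ (n - 1)\<close>. So two of them agree, and the difference of the two coefficient vectors
  is the required \<open>c\<close>.
\<close>

text \<open>Peel off the minimum and the maximum, which lie at least \<open>card A - 1\<close>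
  apart, and induct on the rest. Doubling keeps the centre \<open>m / 2\<close> integral; leaving
  \<open>m\<close> free, rather than tied to the mean of \<open>A\<close>, lets the same
  \<open>m\<close> serve the smaller set.\<close>

lemma sum_squares_distinct_ge:
  fixes A :: "int set" and m :: int
  assumes "finite A"
  shows "int (card A) * ((int (card A))\<^sup>2 - 1) \<le> 3 * (\<Sum>a\<in>A. (2 * a - m)\<^sup>2)"
  using assms
proof (induction "card A" arbitrary: A rule: less_induct)
  case less
  show ?case
  proof (cases "card A \<le> 1")
    case True
    then have "card A = 0 \<or> card A = 1" by linarith
    then have "int (card A) * ((int (card A))\<^sup>2 - 1) = 0" by auto
    then show ?thesis by (simp only:) (simp add: sum_nonneg)
  next
    case False
    define u v B where "u = Min A" and "v = Max A" and "B = A - {u, v}"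
    have ne: "A \<noteq> {}" using False by auto
    have uv: "u \<in> A" "v \<in> A" using less.prems ne by (auto simp: u_def v_def)
    have sub: "A \<subseteq> {u..v}" using less.prems by (auto simp: u_def v_def)
    then have "card A \<le> card {u..v}" by (intro card_mono) auto
    then have width: "int (card A) - 1 \<le> v - u" using False by auto
    have neq: "u \<noteq> v" using width False by auto
    have cardB: "card B = card A - 2"
      using uv neq less.prems by (simp add: B_def card_Diff_subset)
    have "(\<Sum>a\<in>A. (2 * a - m)\<^sup>2) = (\<Sum>a\<in>B. (2 * a - m)\<^sup>2) + (\<Sum>a\<in>{u, v}. (2 * a - m)\<^sup>2)"
      unfolding B_def using uv less.prems by (intro sum.subset_diff) auto
    then have split: "(\<Sum>a\<in>A. (2 * a - m)\<^sup>2)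
        = (\<Sum>a\<in>B. (2 * a - m)\<^sup>2) + (2 * u - m)\<^sup>2 + (2 * v - m)\<^sup>2"
      using neq by simp
    have IH: "int (card B) * ((int (card B))\<^sup>2 - 1) \<le> 3 * (\<Sum>a\<in>B. (2 * a - m)\<^sup>2)"
      using less.prems cardB False by (intro less.hyps) (auto simp: B_def)
    define N where "N = int (card A)"
    have NB: "int (card B) = N - 2" using cardB False by (simp add: N_def)
    have "(N - 1)\<^sup>2 \<le> (v - u)\<^sup>2"
      using width False by (intro power_mono) (auto simp: N_def)
    moreover have "0 \<le> (2 * u + 2 * v - 2 * m)\<^sup>2" by simp
    \<comment> \<open>Parallelogram identity for \<open>2 * u - m\<close> and
      \<open>2 * v - m\<close>: the gap between the endpoints bounds their contribution wherever the
      centre lies.\<close>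
    moreover have "2 * ((2 * u - m)\<^sup>2 + (2 * v - m)\<^sup>2)
        = 4 * (v - u)\<^sup>2 + (2 * u + 2 * v - 2 * m)\<^sup>2"
      by (simp add: power2_eq_square algebra_simps)
    moreover have "2 * p \<le> s" if "p \<le> q" "0 \<le> r" "2 * s = 4 * q + r" for p q r s :: int
      using that by linarith
    ultimately have ends: "2 * (N - 1)\<^sup>2 \<le> (2 * u - m)\<^sup>2 + (2 * v - m)\<^sup>2" by blast
    \<comment> \<open>Passing from \<open>N - 2\<close> to \<open>N\<close> raises the cubic by
      exactly three times the bound in \<open>ends\<close>.\<close>
    have "N * (N\<^sup>2 - 1) = (N - 2) * ((N - 2)\<^sup>2 - 1) + 6 * (N - 1)\<^sup>2"
      by (simp add: power2_eq_square algebra_simps)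
    also have "\<dots> \<le> 3 * (\<Sum>a\<in>A. (2 * a - m)\<^sup>2)"
      using IH ends unfolding NB split by simp
    finally show ?thesis by (simp add: N_def)
  qed
qed

text \<open>The reflection \<open>k\<close> to \<open>d - k\<close> flips the sign of each summand.
  This is what kills the mixed terms of the variance.\<close>

lemma sum_centered: "(\<Sum>k\<in>{0..int d}. 2 * k - int d) = 0"
proof -
  have "(\<Sum>k\<in>{0..int d}. 2 * k - int d) = (\<Sum>k\<in>{0..int d}. 2 * (int d - k) - int d)"
    by (rule sum.reindex_bij_witness[of _ "\<lambda>k. int d - k" "\<lambda>k. int d - k"]) auto
  also have "\<dots> = - (\<Sum>k\<in>{0..int d}. 2 * k - int d)"
    by (simp add: sum_negf[symmetric])
  finally show ?thesis by simp
qed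

lemma sum_centered_squares:
  "3 * (\<Sum>k\<in>{0..int d}. (2 * k - int d)\<^sup>2) = (int d + 1) * ((int d + 1)\<^sup>2 - 1)"
proof -
  \<comment> \<open>The offset \<open>m\<close> is decoupled from the range \<open>n\<close>, since
    with \<open>m = n\<close> it would change at each induction step.\<close>
  have "3 * (\<Sum>k\<le>n. (2 * int k - m)\<^sup>2)
      = (int n + 1) * (2 * int n * (2 * int n + 1) - 6 * m * int n + 3 * m\<^sup>2)" for n m
    by (induction n) (simp_all add: power2_eq_square algebra_simps)
  note this[of "int d" d]
  moreover have "(\<Sum>k\<in>{0..int d}. (2 * k - int d)\<^sup>2) = (\<Sum>k\<le>d. (2 * int k - int d)\<^sup>2)"
    by (rule sum.reindex_bij_witness[of _ int nat]) auto
  ultimately show ?thesis by (simp add: power2_eq_square algebra_simps)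
qed

text \<open>Up to scaling this is the covariance of two coordinates of a uniform \<open>c\<close>:
  by independence the sum factors over the coordinates, and for distinct \<open>i\<close> and
  \<open>j\<close> the factor at \<open>i\<close> is a centred sum, hence 0.\<close>

lemma sum_PiE_centered_product:
  assumes "finite I" "i \<in> I" "j \<in> I"
  shows "(\<Sum>c\<in>PiE I (\<lambda>_. {0..int d}). (2 * c i - int d) * (2 * c j - int d))
    = (if i = j then (int d + 1) ^ (card I - 1) * (\<Sum>k\<in>{0..int d}. (2 * k - int d)\<^sup>2) else 0)"
proof -
  define g where "g = (\<lambda>k. 2 * k - int d)"
  \<comment> \<open>Padding with factors 1 turns the summand into a product over all of
    \<open>I\<close>; for \<open>i = j\<close> both conditions hold at that index and yield the
    square.\<close>
  define h where "h l k = (if l = i then g k else 1) * (if l = j then g k else 1)" for l k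
  have "(\<Sum>c\<in>PiE I (\<lambda>_. {0..int d}). g (c i) * g (c j))
      = (\<Sum>c\<in>PiE I (\<lambda>_. {0..int d}). \<Prod>l\<in>I. h l (c l))"
    using assms by (simp add: h_def prod.distrib)
  also have "\<dots> = (\<Prod>l\<in>I. \<Sum>k\<in>{0..int d}. h l k)"
    using assms by (intro prod_sum_PiE[symmetric]) auto
  also have "\<dots> = (\<Sum>k\<in>{0..int d}. h i k) * (\<Prod>l\<in>I - {i}. \<Sum>k\<in>{0..int d}. h l k)"
    using assms by (simp add: prod.remove)
  also have "\<dots> = (if i = j then (int d + 1) ^ (card I - 1) * (\<Sum>k\<in>{0..int d}. (g k)\<^sup>2) else 0)"
  proof (cases "i = j")
    case True
    have "(\<Prod>l\<in>I - {i}. \<Sum>k\<in>{0..int d}. h l k) = (\<Prod>l\<in>I - {i}. int d + 1)"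
      using True by (intro prod.cong) (auto simp: h_def)
    then show ?thesis
      using True assms by (simp add: h_def power2_eq_square)
  next
    case False
    then have "(\<Sum>k\<in>{0..int d}. h i k) = 0"
      using sum_centered[of d] by (simp add: h_def g_def)
    then show ?thesis using False by simp
  qed
  finally show ?thesis by (simp add: g_def)
qed

text \<open>The variance of a sum of independent variables: after expanding the square only the
  diagonal terms survive.\<close>

lemma sum_PiE_centered_squares:
  fixes y :: "'a \<Rightarrow> int"
  assumes "finite I"
  shows "3 * (\<Sum>c\<in>PiE I (\<lambda>_. {0..int d}). (\<Sum>i\<in>I. (2 * c i - int d) * y i)\<^sup>2)
    = (int d + 1) ^ card I * ((int d + 1)\<^sup>2 - 1) * (\<Sum>i\<in>I. (y i)\<^sup>2)"
proof (cases "I = {}")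
  case False
  let ?P = "PiE I (\<lambda>_. {0..int d})"
  define q where "q = (int d + 1) ^ (card I - 1) * (\<Sum>k\<in>{0..int d}. (2 * k - int d)\<^sup>2)"
  have "(\<Sum>c\<in>?P. (\<Sum>i\<in>I. (2 * c i - int d) * y i)\<^sup>2)
      = (\<Sum>c\<in>?P. \<Sum>i\<in>I. \<Sum>j\<in>I. y i * y j * ((2 * c i - int d) * (2 * c j - int d)))"
    unfolding power2_eq_square sum_product by (intro sum.cong refl) (simp only: mult_ac)
  also have "\<dots> = (\<Sum>i\<in>I. \<Sum>c\<in>?P. \<Sum>j\<in>I. y i * y j * ((2 * c i - int d) * (2 * c j - int d)))"
    by (rule sum.swap)
  also have "\<dots> = (\<Sum>i\<in>I. \<Sum>j\<in>I. \<Sum>c\<in>?P. y i * y j * ((2 * c i - int d) * (2 * c j - int d)))"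
    by (intro sum.cong refl sum.swap)
  also have "\<dots> = (\<Sum>i\<in>I. \<Sum>j\<in>I. y i * y j * (if i = j then q else 0))"
    using assms
    by (intro sum.cong refl)
      (simp only: sum_distrib_left[symmetric] sum_PiE_centered_product q_def)
  also have "\<dots> = q * (\<Sum>i\<in>I. (y i)\<^sup>2)"
    using assms by (simp add: if_distrib sum_distrib_left power2_eq_square mult_ac cong: if_cong)
  finally have "3 * (\<Sum>c\<in>?P. (\<Sum>i\<in>I. (2 * c i - int d) * y i)\<^sup>2) = 3 * q * (\<Sum>i\<in>I. (y i)\<^sup>2)"
    by simp
  also have "3 * q = (int d + 1) ^ (card I - 1) * (3 * (\<Sum>k\<in>{0..int d}. (2 * k - int d)\<^sup>2))"
    by (simp add: q_def)
  also have "\<dots> = (int d + 1) ^ Suc (card I - 1) * ((int d + 1)\<^sup>2 - 1)"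
    unfolding sum_centered_squares by simp
  \<comment> \<open>Truncated subtraction makes this fail for empty \<open>I\<close>, hence the case
    split.\<close>
  also have "Suc (card I - 1) = card I" using False assms by (simp add: card_gt_0_iff)
  finally show ?thesis .
qed simp

text \<open>The choice \<open>m = d * sum y I\<close> is twice the mean of the values, so the lower
  bound for distinct integers meets the exact variance; the common factor \<open>N > 0\<close>
  cancels.\<close>

lemma inj_on_PiE_sum_squares_ge:
  fixes y :: "'a \<Rightarrow> int"
  assumes "finite I" and "inj_on (\<lambda>c. \<Sum>i\<in>I. c i * y i) (PiE I (\<lambda>_. {0..int d}))"
  shows "(int d + 1) ^ (2 * card I) - 1 \<le> ((int d + 1)\<^sup>2 - 1) * (\<Sum>i\<in>I. (y i)\<^sup>2)"
proof -
  let ?P = "PiE I (\<lambda>_. {0..int d})" and ?f = "\<lambda>c. \<Sum>i\<in>I. c i * y i"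
  define N where "N = (int d + 1) ^ card I"
  have fin: "finite ?P" using assms(1) by (intro finite_PiE) auto
  have "int (card (?f ` ?P)) = N"
    using assms by (simp add: card_image card_PiE N_def)
  then have "N * (N\<^sup>2 - 1) \<le> 3 * (\<Sum>a\<in>?f ` ?P. (2 * a - int d * sum y I)\<^sup>2)"
    using sum_squares_distinct_ge[of "?f ` ?P" "int d * sum y I"] fin by simp
  also have "(\<Sum>a\<in>?f ` ?P. (2 * a - int d * sum y I)\<^sup>2)
      = (\<Sum>c\<in>?P. (\<Sum>i\<in>I. (2 * c i - int d) * y i)\<^sup>2)"
    by (simp add: sum.reindex[OF assms(2)] left_diff_distrib sum_subtractf sum_distrib_left mult.assoc)
  also have "3 * \<dots> = N * (((int d + 1)\<^sup>2 - 1) * (\<Sum>i\<in>I. (y i)\<^sup>2))"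
    unfolding sum_PiE_centered_squares[OF assms(1)] N_def by simp
  finally have "N\<^sup>2 - 1 \<le> ((int d + 1)\<^sup>2 - 1) * (\<Sum>i\<in>I. (y i)\<^sup>2)"
    by (simp add: N_def)
  then show ?thesis by (simp add: N_def power_mult[symmetric] mult.commute)
qed

lemma exists_small_relation:
  fixes y :: "'a \<Rightarrow> int"
  assumes "finite I" and "i \<in> I" "y i \<noteq> 0"
    and small: "(\<Sum>i\<in>I. (y i)\<^sup>2) < (int d + 1) ^ (2 * (card I - 1))"
  shows "\<exists>c. (\<forall>i\<in>I. c i \<in> {- int d..int d}) \<and> (\<exists>i\<in>I. c i \<noteq> 0) \<and> (\<Sum>i\<in>I. c i * y i) = 0"
proof -
  let ?P = "PiE I (\<lambda>_. {0..int d})"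
  define E where "E = (int d + 1) ^ (2 * (card I - 1))"
  define S where "S = (\<Sum>i\<in>I. (y i)\<^sup>2)"
  have "0 < S" unfolding S_def using assms by (intro sum_pos2[of I i]) auto
  \<comment> \<open>Integrality sharpens the strict bound to \<open>E - 1\<close>; this slack gives
    the contradiction below. As \<open>d = 0\<close> would force \<open>E = 1\<close>, also
    \<open>d\<close> is positive.\<close>
  with small have E: "S \<le> E - 1" "1 < E" unfolding E_def S_def by linarith+
  have "d \<noteq> 0"
  proof
    assume "d = 0"
    then show False using E(2) by (simp add: E_def)
  qed
  then have D: "2\<^sup>2 \<le> (int d + 1)\<^sup>2" by (intro power_mono) auto
  have "card I \<noteq> 0" using assms by auto
  then have "2 * card I = 2 + 2 * (card I - 1)" by simp
  then have pow: "(int d + 1) ^ (2 * card I) = (int d + 1)\<^sup>2 * E"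
    unfolding E_def by (metis power_add)
  have "\<not> inj_on (\<lambda>c. \<Sum>i\<in>I. c i * y i) ?P"
  proof
    assume "inj_on (\<lambda>c. \<Sum>i\<in>I. c i * y i) ?P"
    from inj_on_PiE_sum_squares_ge[OF assms(1) this]
    have "(int d + 1)\<^sup>2 * E - 1 \<le> ((int d + 1)\<^sup>2 - 1) * S" unfolding pow S_def .
    also have "\<dots> \<le> ((int d + 1)\<^sup>2 - 1) * (E - 1)"
      using D E by (intro mult_left_mono) auto
    also have "\<dots> = (int d + 1)\<^sup>2 * E - (int d + 1)\<^sup>2 - E + 1"
      by (simp add: algebra_simps)
    \<comment> \<open>The chain would give \<open>(d + 1)^2 + E\<close> at most 2, whereas the first
      term alone is at least 4.\<close>
    finally show False using D E by simp
  qed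
  then obtain a b where ab: "a \<in> ?P" "b \<in> ?P" "a \<noteq> b"
    "(\<Sum>i\<in>I. a i * y i) = (\<Sum>i\<in>I. b i * y i)"
    unfolding inj_on_def by blast
  \<comment> \<open>Members of \<open>PiE\<close> agree outside \<open>I\<close>, so distinct ones
    differ at an index in \<open>I\<close>.\<close>
  have "\<exists>i\<in>I. a i \<noteq> b i" using ab(1-3) by (meson PiE_ext)
  moreover have "\<forall>i\<in>I. a i - b i \<in> {- int d..int d}" using ab(1,2) by (fastforce simp: PiE_iff)
  moreover have "(\<Sum>i\<in>I. (a i - b i) * y i) = 0"
    using ab(4) by (simp add: left_diff_distrib sum_subtractf)
  ultimately show ?thesis by (intro exI[of _ "\<lambda>i. a i - b i"]) auto
qed

theorem theorem3p1:
  fixes d :: nat and x :: "int ^ 'n"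
  assumes "x \<noteq> 0"
    and "norm (real_of_int_vec x) / real_of_int (GCD i\<in>UNIV. x $ i)
           < (real d + 1) ^ (CARD('n) - 1)"
  shows "\<exists>c :: int ^ 'n. (\<forall>i. c $ i \<in> {- int d..int d}) \<and> c \<noteq> 0 \<and> int_dot c x = 0"
proof -
  define g where "g = (GCD i\<in>UNIV. x $ i)"
  define y where "y i = x $ i div g" for i
  obtain i where i: "x $ i \<noteq> 0" using assms(1) by (auto simp: vec_eq_iff)
  have "g \<noteq> 0" using i by (auto simp: g_def)
  moreover have "0 \<le> g" by (simp add: g_def)
  ultimately have g: "0 < g" by simp
  have x: "x $ i = g * y i" for i
    unfolding y_def by (simp add: g_def)
  have "norm (real_of_int_vec x) = L2_set (\<lambda>i. real_of_int g * real_of_int (y i)) UNIV"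
    by (simp add: norm_vec_def real_of_int_vec_def x L2_set_def)
  also have "\<dots> = real_of_int g * L2_set (\<lambda>i. real_of_int (y i)) UNIV"
    using g by (simp add: L2_set_right_distrib)
  finally have "L2_set (\<lambda>i. real_of_int (y i)) UNIV < (real d + 1) ^ (CARD('n) - 1)"
    using assms(2) g by (simp add: g_def[symmetric])
  \<comment> \<open>Squaring removes the root, so that both sides become integers and the bound can
    be read in \<open>int\<close>.\<close>
  then have "(L2_set (\<lambda>i. real_of_int (y i)) UNIV)\<^sup>2 < ((real d + 1) ^ (CARD('n) - 1))\<^sup>2"
    by (intro power_strict_mono) auto
  then have "real_of_int (\<Sum>i\<in>UNIV. (y i)\<^sup>2) < real_of_int ((int d + 1) ^ (2 * (CARD('n) - 1)))"
    by (simp add: L2_set_def sum_nonneg power_mult[symmetric] mult.commute)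
  then have "(\<Sum>i\<in>UNIV. (y i)\<^sup>2) < (int d + 1) ^ (2 * (CARD('n) - 1))"
    by (simp only: of_int_less_iff)
  moreover have "y i \<noteq> 0" using i x by auto
  ultimately obtain c where c: "\<forall>i. c i \<in> {- int d..int d}" "\<exists>i. c i \<noteq> 0"
    "(\<Sum>i\<in>UNIV. c i * y i) = 0"
    using exists_small_relation[of UNIV i y d] by auto
  have "int_dot (\<chi> i. c i) x = g * (\<Sum>i\<in>UNIV. c i * y i)"
    by (simp add: int_dot_def x sum_distrib_left mult_ac)
  then have "int_dot (\<chi> i. c i) x = 0" using c(3) by simp
  then show ?thesis
    using c(1,2) by (intro exI[of _ "\<chi> i. c i"]) (auto simp: vec_eq_iff)
qed

end
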